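(* Let $G_0,G_1\in\mathbb{Z}$ with $\gcd(G_0,G_1)=1$, and let $(G_n)_{n\ge0}$ satisfy $G_n=G_{n-1}+G_{n-2}$ for $n\ge2$. If $k$ is an odd positive integer, then no prime $p$ with $p\equiv 3,7,13,17\pmod{20}$ divides $\mathcal{G}_{G_0,G_1}(k)$.
   Context: $\mathcal{G}_{G_0,G_1}(k)$ is the greatest common divisor of all integers $\sum_{i=0}^{k-1}G_{n+i}$, $n\ge1$. *)

theory Defs
  imports "HOL-Number_Theory.Number_Theory"
begin

(* Gcd is the library gcd of a possibly infinite set of integers;
   it is 0 exactly when every member of the set is 0. *)
definition gcd_consecutive_sums :: "(nat \<Rightarrow> int) \<Rightarrow> nat \<Rightarrow> int" where
  "gcd_consecutive_sums G k = Gcd {\<Sum>i<k. G (n + i) | n. n \<ge> 1}"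

end

theory Submission
  imports Defs
begin

text \<open>The form \<open>Q(x, y) = y\<^sup>2 - x y - x\<^sup>2\<close> changes sign along consecutive terms of the sequence.
  If \<open>p\<close> divides all sums of \<open>k\<close> consecutive terms, then the sequence has period \<open>k\<close> modulo \<open>p\<close>,
  so for odd \<open>k\<close> we get \<open>2 Q \<equiv> 0\<close>. As \<open>4 Q = (2 y - x)\<^sup>2 - 5 x\<^sup>2\<close> and \<open>5\<close> is not a square
  modulo \<open>p\<close>, the form \<open>Q\<close> is anisotropic modulo \<open>p\<close>, and \<open>p\<close> divides both \<open>G\<^sub>0\<close> and \<open>G\<^sub>1\<close>.\<close>

text \<open>With phi the golden ratio, the form is the norm of y - x phi. One step of the recurrence
  multiplies this element by 1 - phi, a unit of norm -1.\<close>

lemma fib_like_form_alternates: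
  fixes G :: "nat \<Rightarrow> int"
  assumes rec: "\<And>n. G (Suc (Suc n)) = G (Suc n) + G n"
  shows "G (Suc n)^2 - G (Suc n) * G n - G n^2 = (-1)^n * (G 1^2 - G 1 * G 0 - G 0^2)"
proof (induction n)
  case (Suc n)
  have "G (Suc (Suc n))^2 - G (Suc (Suc n)) * G (Suc n) - G (Suc n)^2
      = - (G (Suc n)^2 - G (Suc n) * G n - G n^2)"
    by (simp add: rec algebra_simps power2_eq_square)
  then show ?case using Suc by simp
qed simp

text \<open>Telescoping, since each term is the difference of the two terms after it.\<close>

lemma fib_like_sum:
  fixes G :: "nat \<Rightarrow> int"
  assumes rec: "\<And>n. G (Suc (Suc n)) = G (Suc n) + G n"
  shows "(\<Sum>i<k. G (n + i)) = G (Suc (n + k)) - G (Suc n)"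
  by (induction k) (simp_all add: rec)

text \<open>The four classes modulo 20 are the odd ones that reduce to 2 or 3, the nonsquares modulo
  5. Reciprocity carries this over to 5 modulo \<open>p\<close>.\<close>

lemma not_QuadRes_5:
  fixes p :: nat
  assumes p: "prime p" and p20: "p mod 20 \<in> {3, 7, 13, 17}"
  shows "\<not> QuadRes (int p) 5"
proof -
  have mods: "p mod 2 = p mod 20 mod 2" "p mod 5 = p mod 20 mod 5"
    by (simp_all add: mod_mod_cancel)
  have odd: "p mod 2 = 1" unfolding mods using p20 by auto
  have p5: "p mod 5 = 2 \<or> p mod 5 = 3" unfolding mods using p20 by auto
  have "2 < p" using odd prime_ge_2_nat[OF p] by (cases "p = 2") auto
  have "p \<noteq> 5" using p5 by auto
  have not_sq: "\<not> QuadRes 5 (int p)"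
  proof
    assume "QuadRes 5 (int p)"
    then obtain y where "[y^2 = int p] (mod 5)" unfolding QuadRes_def by blast
    then have "y^2 mod 5 = int (p mod 5)" by (simp add: cong_def zmod_int)
    moreover have "y mod 5 \<in> {0, 1, 2, 3, 4}" by auto
    moreover have "y^2 mod 5 = (y mod 5)^2 mod 5" by (simp add: power_mod)
    ultimately show False using p5 by auto
  qed
  have "\<not> [int p = 0] (mod 5)"
    using p5 by (simp add: cong_def flip: zmod_int) presburger
  with not_sq have "Legendre (int p) 5 = -1" by (simp add: Legendre_def)
  \<comment> \<open>The sign is +1 because (5 - 1) / 2 is even.\<close>
  moreover have "Legendre (int p) (int 5) * Legendre (int 5) (int p) = 1"
    using Quadratic_Reciprocity[of p 5] p \<open>2 < p\<close> \<open>p \<noteq> 5\<close> by simp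
  ultimately have "Legendre 5 (int p) = -1" by simp
  then show ?thesis by (auto simp: Legendre_def split: if_splits)
qed

text \<open>If \<open>x\<close> had an inverse \<open>z\<close> modulo \<open>p\<close>, then
  \<open>(2 * y - x) * z\<close> would be a square root of 5. Once \<open>p\<close> divides
  \<open>x\<close>, only \<open>y^2\<close> is left of the form.\<close>

lemma dvd_of_fib_form_dvd:
  fixes x y :: int and p :: nat
  assumes p: "prime p" and nres: "\<not> QuadRes (int p) 5"
    and dvd: "int p dvd y^2 - y * x - x^2"
  shows "int p dvd x" "int p dvd y"
proof -
  have prime: "prime (int p)" using p by simp
  show x: "int p dvd x"
  proof (rule ccontr)
    assume "\<not> int p dvd x"
    then have "coprime x (int p)"
      using prime_imp_coprime[OF prime] coprime_commute by blast
    then obtain z where z: "[x * z = 1] (mod int p)"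
      using cong_solve_coprime_int by blast
    have "[(2 * y - x)^2 = 5 * x^2] (mod int p)"
    proof -
      have "(2 * y - x)^2 - 5 * x^2 = 4 * (y^2 - y * x - x^2)"
        by (simp add: algebra_simps power2_eq_square)
      then show ?thesis using dvd unfolding cong_iff_dvd_diff by (metis dvd_mult)
    qed
    then have "[(2 * y - x)^2 * z^2 = 5 * x^2 * z^2] (mod int p)"
      by (intro cong_mult cong_refl)
    also have "5 * x^2 * z^2 = 5 * (x * z)^2" by (simp add: power_mult_distrib)
    also have "[5 * (x * z)^2 = 5 * 1^2] (mod int p)"
      by (intro cong_mult cong_pow cong_refl z)
    finally have "[((2 * y - x) * z)^2 = 5] (mod int p)" by (simp add: power_mult_distrib)
    with nres show False unfolding QuadRes_def by blast
  qed
  have "y^2 = (y^2 - y * x - x^2) + x * (y + x)"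
    by (simp add: algebra_simps power2_eq_square)
  then have "int p dvd y^2" using dvd x by (metis dvd_add dvd_mult2)
  then show "int p dvd y" using prime prime_dvd_power by blast
qed

theorem theorem6p5:
  fixes G :: "nat \<Rightarrow> int" and k p :: nat
  assumes "gcd (G 0) (G 1) = 1"
    and "\<And>n. n \<ge> 2 \<Longrightarrow> G n = G (n - 1) + G (n - 2)"
    and "k > 0" and "odd k"
    and "prime p"
    and "[p = 3] (mod 20) \<or> [p = 7] (mod 20) \<or> [p = 13] (mod 20) \<or> [p = 17] (mod 20)"
  shows "\<not> int p dvd gcd_consecutive_sums G k"
proof
  assume dvd: "int p dvd gcd_consecutive_sums G k"
  have rec: "G (Suc (Suc n)) = G (Suc n) + G n" for n
    using assms(2)[of "Suc (Suc n)"] by simp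
  define Q where "Q n = G (Suc n)^2 - G (Suc n) * G n - G n^2" for n
  have Q: "Q n = (-1)^n * Q 0" for n
    using fib_like_form_alternates[of G n] rec by (simp add: Q_def)
  have p20: "p mod 20 \<in> {3, 7, 13, 17}" using assms(6) by (auto simp: cong_def)
  then have "p \<noteq> 2" by auto
  have period: "[G (Suc (n + k)) = G (Suc n)] (mod int p)" if "n \<ge> 1" for n
  proof -
    have "gcd_consecutive_sums G k dvd (\<Sum>i<k. G (n + i))"
      unfolding gcd_consecutive_sums_def by (rule Gcd_dvd) (use that in blast)
    then have "int p dvd (\<Sum>i<k. G (n + i))" using dvd dvd_trans by blast
    then show ?thesis by (simp add: fib_like_sum[of G, OF rec] cong_iff_dvd_diff)
  qed
  \<comment> \<open>The sums start at \<open>n \<ge> 1\<close> and telescope to indices shifted by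
    one, so periodicity is known only from \<open>G 2\<close> on; \<open>Q 2\<close> is the first
    value of the form that it covers.\<close>
  have "[Q (2 + k) = Q 2] (mod int p)"
    unfolding Q_def using period[of 1] period[of 2]
    by (intro cong_diff cong_mult cong_pow) (simp_all add: eval_nat_numeral)
  \<comment> \<open>Here \<open>2 + k\<close> is odd, so the two sides carry opposite signs.\<close>
  then have "[- Q 0 = Q 0] (mod int p)"
    using Q[of "2 + k"] Q[of 2] \<open>odd k\<close> by simp
  then have "int p dvd 2 * Q 0" by (simp add: cong_iff_dvd_diff)
  moreover have "\<not> int p dvd 2"
    using \<open>p \<noteq> 2\<close> \<open>prime p\<close> primes_dvd_imp_eq[of "int p" 2] by auto
  ultimately have "int p dvd Q 0"
    using \<open>prime p\<close> by (simp add: prime_dvd_mult_iff)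
  then have "int p dvd G 0" "int p dvd G 1"
    using dvd_of_fib_form_dvd[OF \<open>prime p\<close> not_QuadRes_5[OF \<open>prime p\<close> p20], of "G 1" "G 0"]
    by (simp_all add: Q_def)
  then have "int p dvd gcd (G 0) (G 1)" by (rule gcd_greatest)
  then show False using assms(1) \<open>prime p\<close> by (metis not_prime_unit prime_int_nat_transfer prime_nat_int_transfer)
qed

end
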